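(* For $i=1,2$ let $q_i\ge 2$ and let $F_i$ be an $F(n_i,q_i^{m_i})$ with constant coincidence numbers $\lambda_i$ between its different rows and with no fully aliased columns. Let $D$ be a normalized difference matrix $\mathrm{ND}(rq_1,n_2,q_1)$ defined on an Abelian group $\mathcal{A}_1=\{0,\ldots,q_1-1\}$, without identical rows. Then $$F=(F_1\oplus_{\mathcal{A}_1}D',\; 0_{n_1}\oplus F_2)$$ is an $F(n_1n_2,q_1^{rm_1q_1}q_2^{m_2})$ without fully aliased columns. Furthermore: (a) if $|(\lambda_2+rm_1)-(m_2+\lambda_1rq_1)|\le 1$, then $F$ is $E(f_{\mathrm{NOD}})$-optimal; (b) if $q_2\lambda_2+q_1rm_1=q_2m_2+\lambda_1rq_1^2$, then $F$ is $\chi^2$-optimal.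
   Context: Prime denotes transpose; $0_{n}$ is the $n\times 1$ zero vector. An $F(n,q_1\cdots q_m)$ is an $n\times m$ matrix whose $j$th column has entries in $\{0,\ldots,q_j-1\}$ and is balanced (each of the $q_j$ symbols occurs equally often); $F(n,q_1^{r_1}\cdots q_l^{r_l})$ indicates $r_i$ columns with $q_i$ levels. Two columns are fully aliased if one can be obtained from the other by permuting the levels (columns with different numbers of levels are never fully aliased); a design has no fully aliased columns if no two columns in distinct positions are fully aliased. The coincidence number between two rows is the number of columns in which they have the same entry. A difference matrix $D(rq,c,q)$ is an $rq\times c$ array with entries from a finite Abelian group $(\mathcal{A},+)$ with $q$ elements such that each element of $\mathcal{A}$ appears equally often in the vector of differences between any two distinct columns. A difference matrix with $c>1$ is normalized, written $\mathrm{ND}(rq,c,q)$, if its first column consists of all zeros, $0$ being the identity of $\mathcal{A}$. For $A=(a_{ij})$, the Kronecker sum $A\oplus B$ (respectively $A\oplus_{\mathcal{A}}B$) is the block matrix whose $(i,j)$ block is obtained by adding $a_{ij}$ to every entry of $B$, with ordinary addition (respectively addition in $\mathcal{A}$). Thus $0_{n_1}\oplus F_2$ is $n_1$ copies of $F_2$ stacked vertically. For columns $f^i,f^j$ of an $F(n,q_1\cdots q_m)$ put $$f_{\mathrm{NOD}}(f^i,f^j)=\sum_{a=0}^{q_i-1}\sum_{b=0}^{q_j-1}\Big(n_{ab}(f^i,f^j)-\frac{n}{q_iq_j}\Big)^2,$$ where $n_{ab}(f^i,f^j)$ is the number of rows in which $(f^i,f^j)$ equals $(a,b)$. Define $E(f_{\mathrm{NOD}})=\frac{2}{m(m-1)}\sum_{1\le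 i<j\le m}f_{\mathrm{NOD}}(f^i,f^j)$ and $\chi^2=\sum_{1\le i<j\le m}q_iq_jf_{\mathrm{NOD}}(f^i,f^j)/n$. A design is $E(f_{\mathrm{NOD}})$-optimal (respectively $\chi^2$-optimal) if it minimizes $E(f_{\mathrm{NOD}})$ (respectively $\chi^2$) among all balanced designs with the same number of runs and the same numbers of levels of the columns. *)

theory Defs
  imports "Jordan_Normal_Form.Matrix" "HOL-Algebra.Coset" "HOL-Combinatorics.Permutations"
begin

text \<open>
  Rows and columns are numbered from 0. The list \<open>qs\<close> gives the numbers of levels of the columns,
  so \<open>design n [q\<^sub>1, ..., q\<^sub>m]\<close> is the class written $F(n, q_1 \cdots q_m)$.
\<close>

definition balanced_column :: "nat \<Rightarrow> nat vec \<Rightarrow> bool" where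
  "balanced_column q v \<longleftrightarrow>
     (\<forall>u<dim_vec v. v $ u < q) \<and>
     (\<forall>a<q. \<forall>b<q. card {u. u < dim_vec v \<and> v $ u = a} = card {u. u < dim_vec v \<and> v $ u = b})"

definition design :: "nat \<Rightarrow> nat list \<Rightarrow> nat mat \<Rightarrow> bool" where
  "design n qs F \<longleftrightarrow>
     F \<in> carrier_mat n (length qs) \<and> (\<forall>j<length qs. balanced_column (qs ! j) (col F j))"

definition fully_aliased :: "nat list \<Rightarrow> nat mat \<Rightarrow> nat \<Rightarrow> nat \<Rightarrow> bool" where
  "fully_aliased qs F i j \<longleftrightarrow>
     qs ! i = qs ! j \<and>
     (\<exists>\<pi>. \<pi> permutes {..<qs ! i} \<and> (\<forall>u<dim_row F. F $$ (u, j) = \<pi> (F $$ (u, i))))"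

definition no_fully_aliased_columns :: "nat list \<Rightarrow> nat mat \<Rightarrow> bool" where
  "no_fully_aliased_columns qs F \<longleftrightarrow>
     (\<forall>i<length qs. \<forall>j<length qs. i \<noteq> j \<longrightarrow> \<not> fully_aliased qs F i j)"

definition coincidence_number :: "'a mat \<Rightarrow> nat \<Rightarrow> nat \<Rightarrow> nat" where
  "coincidence_number F u v = card {j. j < dim_col F \<and> F $$ (u, j) = F $$ (v, j)}"

definition constant_coincidence :: "'a mat \<Rightarrow> nat \<Rightarrow> bool" where
  "constant_coincidence F l \<longleftrightarrow>
     (\<forall>u<dim_row F. \<forall>v<dim_row F. u \<noteq> v \<longrightarrow> coincidence_number F u v = l)"

definition identical_rows_free :: "'a mat \<Rightarrow> bool" where
  "identical_rows_free D \<longleftrightarrow>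
     (\<forall>k<dim_row D. \<forall>l<dim_row D. k \<noteq> l \<longrightarrow> row D k \<noteq> row D l)"

text \<open>
  The underlying Abelian group is an arbitrary one, in the multiplicative notation of
  HOL-Algebra: the difference of \<open>x\<close> and \<open>y\<close> is \<open>x \<otimes> inv y\<close>, and the zero is \<open>\<one>\<close>.
\<close>

definition difference_matrix ::
    "('a, 'z) monoid_scheme \<Rightarrow> nat \<Rightarrow> nat \<Rightarrow> nat \<Rightarrow> 'a mat \<Rightarrow> bool" where
  "difference_matrix \<A> r c q D \<longleftrightarrow>
     comm_group \<A> \<and> finite (carrier \<A>) \<and> order \<A> = q \<and>
     D \<in> carrier_mat (r * q) c \<and>
     (\<forall>k<r * q. \<forall>j<c. D $$ (k, j) \<in> carrier \<A>) \<and>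
     (\<forall>i<c. \<forall>j<c. i \<noteq> j \<longrightarrow>
        (\<forall>x\<in>carrier \<A>. \<forall>y\<in>carrier \<A>.
           card {k. k < r * q \<and> D $$ (k, i) \<otimes>\<^bsub>\<A>\<^esub> inv\<^bsub>\<A>\<^esub> (D $$ (k, j)) = x} =
           card {k. k < r * q \<and> D $$ (k, i) \<otimes>\<^bsub>\<A>\<^esub> inv\<^bsub>\<A>\<^esub> (D $$ (k, j)) = y}))"

definition normalized_difference_matrix ::
    "('a, 'z) monoid_scheme \<Rightarrow> nat \<Rightarrow> nat \<Rightarrow> nat \<Rightarrow> 'a mat \<Rightarrow> bool" where
  "normalized_difference_matrix \<A> r c q D \<longleftrightarrow>
     difference_matrix \<A> r c q D \<and> c > 1 \<and> (\<forall>k<r * q. D $$ (k, 0) = \<one>\<^bsub>\<A>\<^esub>)"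

text \<open>
  The Kronecker sum with respect to an addition \<open>f\<close>: the block in position \<open>(i, j)\<close> is \<open>B\<close> with
  \<open>A $$ (i, j)\<close> added to every entry.
\<close>

definition kronecker_sum :: "('a \<Rightarrow> 'a \<Rightarrow> 'a) \<Rightarrow> 'a mat \<Rightarrow> 'a mat \<Rightarrow> 'a mat" where
  "kronecker_sum f A B =
     mat (dim_row A * dim_row B) (dim_col A * dim_col B)
       (\<lambda>(u, v). f (A $$ (u div dim_row B, v div dim_col B)) (B $$ (u mod dim_row B, v mod dim_col B)))"

definition append_columns :: "'a mat \<Rightarrow> 'a mat \<Rightarrow> 'a mat" where
  "append_columns A B =
     mat (dim_row A) (dim_col A + dim_col B)
       (\<lambda>(u, v). if v < dim_col A then A $$ (u, v) else B $$ (u, v - dim_col A))"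

definition pair_count :: "nat mat \<Rightarrow> nat \<Rightarrow> nat \<Rightarrow> nat \<Rightarrow> nat \<Rightarrow> nat" where
  "pair_count F i j a b = card {u. u < dim_row F \<and> F $$ (u, i) = a \<and> F $$ (u, j) = b}"

definition f_NOD :: "nat list \<Rightarrow> nat mat \<Rightarrow> nat \<Rightarrow> nat \<Rightarrow> real" where
  "f_NOD qs F i j =
     (\<Sum>a<qs ! i. \<Sum>b<qs ! j.
        (real (pair_count F i j a b) - real (dim_row F) / (real (qs ! i) * real (qs ! j)))\<^sup>2)"

definition E_f_NOD :: "nat list \<Rightarrow> nat mat \<Rightarrow> real" where
  "E_f_NOD qs F =
     2 / (real (length qs) * (real (length qs) - 1)) * (\<Sum>j<length qs. \<Sum>i<j. f_NOD qs F i j)"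

definition chi2 :: "nat list \<Rightarrow> nat mat \<Rightarrow> real" where
  "chi2 qs F =
     (\<Sum>j<length qs. \<Sum>i<j. real (qs ! i) * real (qs ! j) * f_NOD qs F i j / real (dim_row F))"

definition E_f_NOD_optimal :: "nat \<Rightarrow> nat list \<Rightarrow> nat mat \<Rightarrow> bool" where
  "E_f_NOD_optimal n qs F \<longleftrightarrow>
     design n qs F \<and> (\<forall>G. design n qs G \<longrightarrow> E_f_NOD qs F \<le> E_f_NOD qs G)"

definition chi2_optimal :: "nat \<Rightarrow> nat list \<Rightarrow> nat mat \<Rightarrow> bool" where
  "chi2_optimal n qs F \<longleftrightarrow>
     design n qs F \<and> (\<forall>G. design n qs G \<longrightarrow> chi2 qs F \<le> chi2 qs G)"

end

(*
  Write W(u, v) for the (weighted) number of columns in which rows u and v agree.  The sum of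
  W(u, v)^2 over all pairs of rows equals twice the weighted sum of the f_NOD, up to a constant
  depending only on n and the level numbers; the sum of the W(u, v) is such a constant as well.
  Hence a design is optimal as soon as W takes, off the diagonal, a single value, or two
  consecutive integers in the unweighted case: then (W - c) * (W - d) vanishes on it and is
  nonnegative on every competitor.  In F, two rows with indices t, t' inside their
  blocks of length n2 agree in r m1 + l2 columns if t and t' differ (by the difference property of D),
  and in l1 r q1 + m2 columns if t = t' (by cancellation in the group).
*)
theory Submission
  imports Defs
begin

section \<open>Counting and reindexing of finite sums\<close>

lemma card_eq_sum_of_bool:
  "real (card {k. k < n \<and> P k}) = (\<Sum>k<(n::nat). of_bool (P k))"
proof -
  have "{k. k < n \<and> P k} = {..<n} \<inter> {k. P k}" by auto
  then show ?thesis by (simp add: sum_of_bool_eq)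
qed

text \<open>The range is cut into \<open>m\<close> consecutive blocks of length \<open>k\<close>;
  this turns the row or column index of a Kronecker sum into a pair of indices.\<close>

lemma sum_divmod:
  fixes f :: "nat \<Rightarrow> nat \<Rightarrow> 'a::comm_monoid_add"
  shows "(\<Sum>v<m * k. f (v div k) (v mod k)) = (\<Sum>i<m. \<Sum>j<k. f i j)"
proof (cases "k = 0")
  case False
  have "(\<Sum>v<m * k. f (v div k) (v mod k)) = (\<Sum>i<m. \<Sum>v=i*k..<i*k+k. f (v div k) (v mod k))"
    by (simp add: sum.nat_group)
  also have "\<dots> = (\<Sum>i<m. \<Sum>j<k. f i j)"
  proof (rule sum.cong[OF refl])
    fix i
    have "(\<Sum>v=i*k..<i*k+k. f (v div k) (v mod k))
      = (\<Sum>j=0..<k. f ((j + i*k) div k) ((j + i*k) mod k))"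
      using sum.shift_bounds_nat_ivl[of "\<lambda>v. f (v div k) (v mod k)" 0 "i*k" k]
      by (simp add: add.commute)
    also have "\<dots> = (\<Sum>j<k. f i j)"
      using False by (intro sum.cong) auto
    finally show "(\<Sum>v=i*k..<i*k+k. f (v div k) (v mod k)) = (\<Sum>j<k. f i j)" .
  qed
  finally show ?thesis .
qed simp

lemma sum_lessThan_add:
  fixes f :: "nat \<Rightarrow> 'a::comm_monoid_add"
  shows "(\<Sum>v<a + b. f v) = (\<Sum>v<a. f v) + (\<Sum>v<b. f (a + v))"
  by (induction b) (simp_all add: add.assoc)

lemma square_sum_lessThan:
  fixes x :: "nat \<Rightarrow> real"
  shows "(\<Sum>j<m. x j)\<^sup>2 = (\<Sum>j<m. (x j)\<^sup>2) + 2 * (\<Sum>j<m. \<Sum>i<j. x i * x j)"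
  by (induction m) (simp_all add: power2_sum sum_distrib_left sum_distrib_right algebra_simps)

text \<open>The fibres of \<open>h\<close> over \<open>A\<close> partition \<open>{..<n}\<close> and
  are equally large. This serves both the levels of a balanced column and the differences of two
  columns of \<open>D\<close>.\<close>

lemma equal_counts_lessThan:
  assumes "\<And>k. k < n \<Longrightarrow> h k \<in> A" and "finite A"
    and "\<And>x y. x \<in> A \<Longrightarrow> y \<in> A \<Longrightarrow> card {k. k < n \<and> h k = x} = card {k. k < n \<and> h k = y}"
    and "x \<in> A"
  shows "card A * card {k. k < (n::nat) \<and> h k = x} = n"
proof -
  have "n = card (\<Union>y\<in>A. {k. k < n \<and> h k = y})"
  proof -
    have "(\<Union>y\<in>A. {k. k < n \<and> h k = y}) = {..<n}" using assms(1) by auto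
    then show ?thesis by simp
  qed
  also have "\<dots> = (\<Sum>y\<in>A. card {k. k < n \<and> h k = y})"
    by (rule card_UN_disjoint) (use assms(2) in auto)
  also have "\<dots> = (\<Sum>y\<in>A. card {k. k < n \<and> h k = x})"
    by (rule sum.cong[OF refl]) (rule assms(3)[OF _ assms(4)])
  finally show ?thesis by simp
qed

subsection \<open>Weighted coincidence numbers\<close>

lemma design_iff:
  "design n qs F \<longleftrightarrow> F \<in> carrier_mat n (length qs) \<and>
     (\<forall>j<length qs. (\<forall>u<n. F $$ (u, j) < qs ! j) \<and>
        (\<forall>a<qs ! j. \<forall>b<qs ! j.
          card {u. u < n \<and> F $$ (u, j) = a} = card {u. u < n \<and> F $$ (u, j) = b}))"
proof -
  have "balanced_column (qs ! j) (col F j) \<longleftrightarrow> (\<forall>u<n. F $$ (u, j) < qs ! j) \<and>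
        (\<forall>a<qs ! j. \<forall>b<qs ! j.
          card {u. u < n \<and> F $$ (u, j) = a} = card {u. u < n \<and> F $$ (u, j) = b})"
    if F: "F \<in> carrier_mat n (length qs)" and j: "j < length qs" for j
  proof -
    have "{u. u < dim_vec (col F j) \<and> col F j $ u = a} = {u. u < n \<and> F $$ (u, j) = a}" for a
      using F j by (auto simp: index_col)
    moreover have "(\<forall>u<dim_vec (col F j). col F j $ u < qs ! j) \<longleftrightarrow> (\<forall>u<n. F $$ (u, j) < qs ! j)"
      using F j by (auto simp: index_col)
    ultimately show ?thesis unfolding balanced_column_def by simp
  qed
  then show ?thesis unfolding design_def by blast
qed

lemma design_less: "design n qs F \<Longrightarrow> j < length qs \<Longrightarrow> u < n \<Longrightarrow> F $$ (u, j) < qs ! j"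
  unfolding design_iff by blast

lemma design_level_card_unique:
  "design n qs F \<Longrightarrow> j < length qs \<Longrightarrow> a < qs ! j \<Longrightarrow> b < qs ! j \<Longrightarrow>
    card {u. u < n \<and> F $$ (u, j) = a} = card {u. u < n \<and> F $$ (u, j) = b}"
  unfolding design_iff by blast

lemma design_level_card:
  assumes "design n qs F" "j < length qs" "a < qs ! j"
  shows "qs ! j * card {u. u < n \<and> F $$ (u, j) = a} = n"
proof -
  have "card {..<qs ! j} * card {u. u < n \<and> F $$ (u, j) = a} = n"
  proof (rule equal_counts_lessThan)
    fix x y assume "x \<in> {..<qs ! j}" "y \<in> {..<qs ! j}"
    then show "card {u. u < n \<and> F $$ (u, j) = x} = card {u. u < n \<and> F $$ (u, j) = y}"
      using design_level_card_unique[OF assms(1,2)] by blast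
  next
    fix u assume "u < n"
    then show "F $$ (u, j) \<in> {..<qs ! j}" using design_less[OF assms(1,2)] by simp
  qed (use assms in simp_all)
  then show ?thesis by simp
qed

text \<open>Real-valued and 0/1, so that products express simultaneous agreement and squaring
  changes nothing.\<close>

definition agree :: "nat mat \<Rightarrow> nat \<Rightarrow> nat \<Rightarrow> nat \<Rightarrow> real" where
  "agree F j u v = of_bool (F $$ (u, j) = F $$ (v, j))"

text \<open>Weights \<open>1\<close> give the coincidence number and lead to \<open>E_f_NOD\<close>;
  weights \<open>qs ! j\<close> lead to \<open>chi2\<close>.\<close>

definition weighted_coincidence :: "(nat \<Rightarrow> real) \<Rightarrow> nat mat \<Rightarrow> nat \<Rightarrow> nat \<Rightarrow> real" where
  "weighted_coincidence w F u v = (\<Sum>j<dim_col F. w j * agree F j u v)"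

lemma coincidence_number_eq_sum: "real (coincidence_number F u v) = (\<Sum>j<dim_col F. agree F j u v)"
  unfolding coincidence_number_def agree_def by (rule card_eq_sum_of_bool)

text \<open>By balance, each row shares its level with exactly \<open>n / qs ! j\<close> rows,
  itself included.\<close>

lemma sum_agree:
  assumes "design n qs F" "j < length qs" "qs ! j > 0"
  shows "(\<Sum>u<n. \<Sum>v<n. agree F j u v) = (real n)\<^sup>2 / real (qs ! j)"
proof -
  have "(\<Sum>v<n. agree F j u v) = real n / real (qs ! j)" if "u < n" for u
  proof -
    have "F $$ (u, j) < qs ! j" using assms that design_less by blast
    from design_level_card[OF assms(1,2) this]
    have "real (qs ! j) * real (card {v. v < n \<and> F $$ (u, j) = F $$ (v, j)}) = real n"
      by (simp add: eq_commute flip: of_nat_mult)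
    then show ?thesis
      using assms(3) by (simp add: agree_def card_eq_sum_of_bool field_simps)
  qed
  then show ?thesis by (simp add: power2_eq_square)
qed

text \<open>The value depends only on \<open>n\<close>, \<open>qs\<close> and \<open>w\<close>, so
  it cancels when two designs of the same class are compared.\<close>

lemma sum_weighted_coincidence:
  assumes F: "design n qs F" and pos: "\<And>j. j < length qs \<Longrightarrow> qs ! j > 0"
  shows "(\<Sum>u<n. \<Sum>v<n. weighted_coincidence w F u v) =
    (\<Sum>j<length qs. w j * ((real n)\<^sup>2 / real (qs ! j)))"
proof -
  have "dim_col F = length qs" using F by (auto simp: design_def)
  then have "(\<Sum>u<n. \<Sum>v<n. weighted_coincidence w F u v) =
    (\<Sum>u<n. \<Sum>j<length qs. \<Sum>v<n. w j * agree F j u v)"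
    unfolding weighted_coincidence_def by (auto intro!: sum.cong sum.swap)
  also have "\<dots> = (\<Sum>j<length qs. w j * (\<Sum>u<n. \<Sum>v<n. agree F j u v))"
    by (subst sum.swap) (simp add: sum_distrib_left)
  also have "\<dots> = (\<Sum>j<length qs. w j * ((real n)\<^sup>2 / real (qs ! j)))"
    by (intro sum.cong refl) (simp add: sum_agree[OF F] pos)
  finally show ?thesis .
qed

lemma sum_of_bool_pair:
  assumes "x < q"
  shows "(\<Sum>a<q. of_bool (x = a) * of_bool (y = a)) = (of_bool (x = (y::nat)) :: real)"
  using assms by (simp add: of_bool_def if_distrib[of "\<lambda>z. z * _"] sum.delta cong: if_cong)

text \<open>The square of \<open>pair_count\<close> counts ordered pairs of rows that both show
  \<open>(a, b)\<close>. Over all level pairs this counts the ordered pairs of rows that agree in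
  both columns.\<close>

lemma sum_pair_count_squares:
  assumes F: "design n qs F" and "i < length qs" "j < length qs"
  shows "(\<Sum>a<qs ! i. \<Sum>b<qs ! j. (real (pair_count F i j a b))\<^sup>2) =
    (\<Sum>u<n. \<Sum>v<n. agree F i u v * agree F j u v)"
proof -
  let ?A = "\<lambda>u a. of_bool (F $$ (u, i) = a) :: real"
  let ?B = "\<lambda>u b. of_bool (F $$ (u, j) = b) :: real"
  have dim: "dim_row F = n" using F by (auto simp: design_def)
  have pc: "real (pair_count F i j a b) = (\<Sum>u<n. ?A u a * ?B u b)" for a b
    unfolding pair_count_def dim by (simp add: card_eq_sum_of_bool of_bool_conj)
  have "(\<Sum>a<qs ! i. \<Sum>b<qs ! j. (real (pair_count F i j a b))\<^sup>2) =
    (\<Sum>a<qs ! i. \<Sum>b<qs ! j. \<Sum>u<n. \<Sum>v<n. (?A u a * ?B u b) * (?A v a * ?B v b))"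
    unfolding pc power2_eq_square sum_product ..
  \<comment> \<open>The interchanges bring the two level sums innermost, where they factor into one
    sum per column.\<close>
  also have "\<dots> = (\<Sum>a<qs ! i. \<Sum>u<n. \<Sum>b<qs ! j. \<Sum>v<n. (?A u a * ?B u b) * (?A v a * ?B v b))"
    by (intro sum.cong refl sum.swap)
  also have "\<dots> = (\<Sum>u<n. \<Sum>a<qs ! i. \<Sum>b<qs ! j. \<Sum>v<n. (?A u a * ?B u b) * (?A v a * ?B v b))"
    by (rule sum.swap)
  also have "\<dots> = (\<Sum>u<n. \<Sum>a<qs ! i. \<Sum>v<n. \<Sum>b<qs ! j. (?A u a * ?B u b) * (?A v a * ?B v b))"
    by (intro sum.cong refl sum.swap)
  also have "\<dots> = (\<Sum>u<n. \<Sum>v<n. \<Sum>a<qs ! i. \<Sum>b<qs ! j. (?A u a * ?B u b) * (?A v a * ?B v b))"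
    by (intro sum.cong refl sum.swap)
  also have "\<dots> = (\<Sum>u<n. \<Sum>v<n. (\<Sum>a<qs ! i. ?A u a * ?A v a) * (\<Sum>b<qs ! j. ?B u b * ?B v b))"
    unfolding sum_product by (intro sum.cong refl) (simp only: ac_simps)
  also have "\<dots> = (\<Sum>u<n. \<Sum>v<n. agree F i u v * agree F j u v)"
    unfolding agree_def using assms
    by (intro sum.cong refl arg_cong2[of _ _ _ _ "(*)"] sum_of_bool_pair) (simp_all add: design_less)
  finally show ?thesis .
qed

text \<open>Each row falls into exactly one cell \<open>(a, b)\<close>.\<close>

lemma sum_pair_count:
  assumes F: "design n qs F" and "i < length qs" "j < length qs"
  shows "(\<Sum>a<qs ! i. \<Sum>b<qs ! j. real (pair_count F i j a b)) = real n"
proof -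
  let ?A = "\<lambda>u a. of_bool (F $$ (u, i) = a) :: real"
  let ?B = "\<lambda>u b. of_bool (F $$ (u, j) = b) :: real"
  have dim: "dim_row F = n" using F by (auto simp: design_def)
  have "(\<Sum>a<qs ! i. \<Sum>b<qs ! j. real (pair_count F i j a b)) =
    (\<Sum>a<qs ! i. \<Sum>b<qs ! j. \<Sum>u<n. ?A u a * ?B u b)"
    unfolding pair_count_def dim by (simp add: card_eq_sum_of_bool of_bool_conj)
  also have "\<dots> = (\<Sum>a<qs ! i. \<Sum>u<n. \<Sum>b<qs ! j. ?A u a * ?B u b)"
    by (intro sum.cong refl sum.swap)
  also have "\<dots> = (\<Sum>u<n. \<Sum>a<qs ! i. \<Sum>b<qs ! j. ?A u a * ?B u b)"
    by (rule sum.swap)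
  also have "\<dots> = (\<Sum>u<n. (\<Sum>a<qs ! i. ?A u a) * (\<Sum>b<qs ! j. ?B u b))"
    unfolding sum_product ..
  also have "\<dots> = (\<Sum>u<n. 1)"
    using assms by (intro sum.cong refl) (simp add: design_less of_bool_def)
  finally show ?thesis by simp
qed

text \<open>When the square is expanded, the cross term contributes minus twice, and the constant
  term plus once, the quotient subtracted on the right.\<close>

lemma f_NOD_eq:
  assumes F: "design n qs F" and ij: "i < length qs" "j < length qs"
    and pos: "qs ! i > 0" "qs ! j > 0"
  shows "f_NOD qs F i j = (\<Sum>u<n. \<Sum>v<n. agree F i u v * agree F j u v)
    - (real n)\<^sup>2 / (real (qs ! i) * real (qs ! j))"
proof -
  let ?c = "real n / (real (qs ! i) * real (qs ! j))"
  have dim: "dim_row F = n" using F by (auto simp: design_def)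
  have "f_NOD qs F i j = (\<Sum>a<qs ! i. \<Sum>b<qs ! j.
      (real (pair_count F i j a b))\<^sup>2 - 2 * ?c * real (pair_count F i j a b) + ?c\<^sup>2)"
    unfolding f_NOD_def dim power2_diff by (simp add: algebra_simps)
  also have "\<dots> = (\<Sum>a<qs ! i. \<Sum>b<qs ! j. (real (pair_count F i j a b))\<^sup>2)
      - 2 * ?c * (\<Sum>a<qs ! i. \<Sum>b<qs ! j. real (pair_count F i j a b))
      + real (qs ! i) * (real (qs ! j) * ?c\<^sup>2)"
    by (simp add: sum.distrib sum_subtractf sum_distrib_left)
  also have "\<dots> = (\<Sum>u<n. \<Sum>v<n. agree F i u v * agree F j u v)
      - 2 * ?c * real n + real (qs ! i) * (real (qs ! j) * ?c\<^sup>2)"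
    by (simp only: sum_pair_count_squares[OF F ij] sum_pair_count[OF F ij])
  moreover have "2 * ?c * real n = 2 * ((real n)\<^sup>2 / (real (qs ! i) * real (qs ! j)))"
    by (simp add: power2_eq_square)
  moreover have "real (qs ! i) * (real (qs ! j) * ?c\<^sup>2) = (real n)\<^sup>2 / (real (qs ! i) * real (qs ! j))"
    using pos by (simp add: power2_eq_square)
  ultimately show ?thesis by linarith
qed

text \<open>The square of a weighted coincidence splits into diagonal terms, again a weighted
  coincidence with weights \<open>(w j)\<^sup>2\<close>, and mixed terms for \<open>i < j\<close>,
  which \<open>f_NOD_eq\<close> evaluates. Everything but the \<open>f_NOD\<close> terms is the same
  for all designs of the class.\<close>

lemma sum_weighted_coincidence_squares:
  assumes F: "design n qs F" and pos: "\<And>j. j < length qs \<Longrightarrow> qs ! j > 0"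
  shows "(\<Sum>u<n. \<Sum>v<n. (weighted_coincidence w F u v)\<^sup>2) =
    (\<Sum>j<length qs. (w j)\<^sup>2 * ((real n)\<^sup>2 / real (qs ! j)))
    + 2 * (\<Sum>j<length qs. \<Sum>i<j. w i * w j *
        (f_NOD qs F i j + (real n)\<^sup>2 / (real (qs ! i) * real (qs ! j))))"
proof -
  have dim: "dim_col F = length qs" using F by (auto simp: design_def)
  have sq: "(weighted_coincidence w F u v)\<^sup>2 = weighted_coincidence (\<lambda>j. (w j)\<^sup>2) F u v
      + 2 * (\<Sum>j<length qs. \<Sum>i<j. w i * w j * (agree F i u v * agree F j u v))" for u v
    unfolding weighted_coincidence_def square_sum_lessThan dim
    by (intro arg_cong2[of _ _ _ _ "(+)"] arg_cong[of _ _ "(*) 2"] sum.cong refl)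
      (simp_all add: agree_def power_mult_distrib)
  have "(\<Sum>u<n. \<Sum>v<n. \<Sum>j<length qs. \<Sum>i<j. w i * w j * (agree F i u v * agree F j u v)) =
      (\<Sum>u<n. \<Sum>j<length qs. \<Sum>v<n. \<Sum>i<j. w i * w j * (agree F i u v * agree F j u v))"
    by (intro sum.cong refl sum.swap)
  also have "\<dots> = (\<Sum>j<length qs. \<Sum>u<n. \<Sum>v<n. \<Sum>i<j. w i * w j * (agree F i u v * agree F j u v))"
    by (rule sum.swap)
  also have "\<dots> = (\<Sum>j<length qs. \<Sum>u<n. \<Sum>i<j. \<Sum>v<n. w i * w j * (agree F i u v * agree F j u v))"
    by (intro sum.cong refl sum.swap)
  also have "\<dots> = (\<Sum>j<length qs. \<Sum>i<j. \<Sum>u<n. \<Sum>v<n. w i * w j * (agree F i u v * agree F j u v))"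
    by (intro sum.cong refl sum.swap)
  also have "\<dots> = (\<Sum>j<length qs. \<Sum>i<j. w i * w j * (\<Sum>u<n. \<Sum>v<n. agree F i u v * agree F j u v))"
    by (simp add: sum_distrib_left)
  also have "\<dots> = (\<Sum>j<length qs. \<Sum>i<j. w i * w j *
        (f_NOD qs F i j + (real n)\<^sup>2 / (real (qs ! i) * real (qs ! j))))"
    by (intro sum.cong refl) (simp add: f_NOD_eq[OF F] pos)
  finally show ?thesis
    unfolding sq sum.distrib by (simp add: sum_weighted_coincidence[OF F pos] flip: sum_distrib_left)
qed

section \<open>Criteria for optimality\<close>

text \<open>The products \<open>(W - c) * (W - d)\<close> are compared pair by pair: off the
  diagonal by the assumptions, on the diagonal because every row agrees with itself in all columns.
  After expansion the linear and constant parts are common to both designs, which leaves the sums of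
  squares.\<close>

lemma weighted_f_NOD_sum_le:
  assumes F: "design n qs F" and G: "design n qs G"
    and pos: "\<And>j. j < length qs \<Longrightarrow> qs ! j > 0"
    and W_F: "\<And>u v. u < n \<Longrightarrow> v < n \<Longrightarrow> u \<noteq> v \<Longrightarrow>
      (weighted_coincidence w F u v - c) * (weighted_coincidence w F u v - d) = 0"
    and W_G: "\<And>u v. u < n \<Longrightarrow> v < n \<Longrightarrow> u \<noteq> v \<Longrightarrow>
      (weighted_coincidence w G u v - c) * (weighted_coincidence w G u v - d) \<ge> 0"
  shows "(\<Sum>j<length qs. \<Sum>i<j. w i * w j * f_NOD qs F i j) \<le>
    (\<Sum>j<length qs. \<Sum>i<j. w i * w j * f_NOD qs G i j)"
proof -
  let ?W = "weighted_coincidence w"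
  have expand: "(\<Sum>u<n. \<Sum>v<n. (?W H u v - c) * (?W H u v - d)) =
      (\<Sum>u<n. \<Sum>v<n. (?W H u v)\<^sup>2) - (c + d) * (\<Sum>u<n. \<Sum>v<n. ?W H u v) + (real n)\<^sup>2 * (c * d)" for H
    by (simp add: sum.distrib sum_subtractf sum_distrib_left algebra_simps power2_eq_square)
  have "(?W F u v - c) * (?W F u v - d) \<le> (?W G u v - c) * (?W G u v - d)" if "u < n" "v < n" for u v
  proof (cases "u = v")
    case True
    have "dim_col F = dim_col G" using F G by (auto simp: design_def)
    then show ?thesis using True by (simp add: weighted_coincidence_def agree_def)
  next
    case False
    show ?thesis using W_F[OF that False] W_G[OF that False] by linarith
  qed
  then have "(\<Sum>u<n. \<Sum>v<n. (?W F u v - c) * (?W F u v - d)) \<le>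
      (\<Sum>u<n. \<Sum>v<n. (?W G u v - c) * (?W G u v - d))"
    by (intro sum_mono) simp
  then have "(\<Sum>u<n. \<Sum>v<n. (?W F u v)\<^sup>2) \<le> (\<Sum>u<n. \<Sum>v<n. (?W G u v)\<^sup>2)"
    unfolding expand by (simp add: sum_weighted_coincidence[OF F pos] sum_weighted_coincidence[OF G pos])
  then show ?thesis
    by (simp add: sum_weighted_coincidence_squares[OF F pos] sum_weighted_coincidence_squares[OF G pos]
        distrib_left sum.distrib)
qed

text \<open>No integer lies strictly between \<open>a\<close> and \<open>b\<close>, so every
  competitor satisfies the sign condition of \<open>weighted_f_NOD_sum_le\<close> with unit
  weights.\<close>

lemma E_f_NOD_optimalI:
  assumes F: "design n qs F" and pos: "\<And>j. j < length qs \<Longrightarrow> qs ! j > 0"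
    and ab: "\<bar>int a - int b\<bar> \<le> 1"
    and W: "\<And>u v. u < n \<Longrightarrow> v < n \<Longrightarrow> u \<noteq> v \<Longrightarrow>
      coincidence_number F u v = a \<or> coincidence_number F u v = b"
  shows "E_f_NOD_optimal n qs F"
  unfolding E_f_NOD_optimal_def
proof (intro conjI allI impI F)
  fix G assume G: "design n qs G"
  have W_eq: "weighted_coincidence (\<lambda>_. 1) H u v = real (coincidence_number H u v)" for H u v
    by (simp add: weighted_coincidence_def coincidence_number_eq_sum)
  have "(real (coincidence_number G u v) - real a) * (real (coincidence_number G u v) - real b) \<ge> 0"
    for u v
  proof -
    have "(int (coincidence_number G u v) - int a) * (int (coincidence_number G u v) - int b) \<ge> 0"
    \<comment> \<open>An integer below the larger of \<open>a\<close> and \<open>b\<close> is at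
      most the smaller one, so both factors have the same sign.\<close>
    proof (cases "int (coincidence_number G u v) \<ge> max (int a) (int b)")
      case False
      then have "int (coincidence_number G u v) \<le> int a" "int (coincidence_number G u v) \<le> int b"
        using ab by linarith+
      then show ?thesis by (simp add: mult_nonpos_nonpos)
    qed simp
    then have "real_of_int ((int (coincidence_number G u v) - int a) *
        (int (coincidence_number G u v) - int b)) \<ge> 0"
      by (rule of_int_nonneg)
    then show ?thesis by simp
  qed
  then have "(\<Sum>j<length qs. \<Sum>i<j. 1 * 1 * f_NOD qs F i j) \<le>
      (\<Sum>j<length qs. \<Sum>i<j. 1 * 1 * f_NOD qs G i j)"
    using W by (intro weighted_f_NOD_sum_le[OF F G pos, of "\<lambda>_. 1" "real a" "real b"])
      (force simp: W_eq)+
  \<comment> \<open>With at most one column this product is \<open>0\<close>, and the prefactor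
    \<open>2 / 0\<close> is \<open>0\<close> as well.\<close>
  moreover have "real (length qs) * (real (length qs) - 1) \<ge> 0"
    by (cases "length qs") simp_all
  ultimately show "E_f_NOD qs F \<le> E_f_NOD qs G"
    unfolding E_f_NOD_def by (intro mult_left_mono) simp_all
qed

text \<open>With weights \<open>qs ! j\<close> the products \<open>w i * w j\<close> are the
  coefficients in \<open>chi2\<close>. Taking \<open>c = d\<close> makes the competitor's term a
  square, hence nonnegative.\<close>

lemma chi2_optimalI:
  assumes F: "design n qs F" and pos: "\<And>j. j < length qs \<Longrightarrow> qs ! j > 0"
    and W: "\<And>u v. u < n \<Longrightarrow> v < n \<Longrightarrow> u \<noteq> v \<Longrightarrow>
      weighted_coincidence (\<lambda>j. real (qs ! j)) F u v = c"
  shows "chi2_optimal n qs F"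
  unfolding chi2_optimal_def
proof (intro conjI allI impI F)
  fix G assume G: "design n qs G"
  have chi2_eq: "chi2 qs H =
      (\<Sum>j<length qs. \<Sum>i<j. real (qs ! i) * real (qs ! j) * f_NOD qs H i j) / real n"
    if "design n qs H" for H
    using that unfolding chi2_def design_def by (auto simp: sum_divide_distrib)
  have "(\<Sum>j<length qs. \<Sum>i<j. real (qs ! i) * real (qs ! j) * f_NOD qs F i j) \<le>
      (\<Sum>j<length qs. \<Sum>i<j. real (qs ! i) * real (qs ! j) * f_NOD qs G i j)"
    using W by (intro weighted_f_NOD_sum_le[OF F G pos, of _ c c]) simp_all
  then show "chi2 qs F \<le> chi2 qs G"
    unfolding chi2_eq[OF F] chi2_eq[OF G] by (rule divide_right_mono) simp
qed

subsection \<open>The Kronecker sum construction\<close>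

text \<open>Holds the data of the construction; the conditions on coincidences, aliasing and
  distinct rows of \<open>D\<close> are stated in the lemmas that use them.\<close>

locale kronecker_design =
  fixes n1 n2 q1 q2 m1 m2 r :: nat
    and \<A>1 (structure)
    and F1 F2 D F :: "nat mat"
    and qs :: "nat list"
  assumes q1: "q1 \<ge> 2" and q2: "q2 \<ge> 2"
    and F1: "design n1 (replicate m1 q1) F1"
    and F2: "design n2 (replicate m2 q2) F2"
    and carrier: "carrier \<A>1 = {0..<q1}"
    and ND: "normalized_difference_matrix \<A>1 r n2 q1 D"
    and F_def: "F = append_columns (kronecker_sum (mult \<A>1) F1 (transpose_mat D))
                                   (kronecker_sum (+) (0\<^sub>m n1 1) F2)"
    and qs_def: "qs = replicate (r * m1 * q1) q1 @ replicate m2 q2"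
begin

text \<open>The number of rows of \<open>D\<close>, that is, the number of columns of
  \<open>F\<close> arising from one column of \<open>F1\<close>.\<close>

abbreviation "K \<equiv> r * q1"

sublocale comm_group \<A>1
  using ND by (simp add: normalized_difference_matrix_def difference_matrix_def)

section \<open>Entries and index arithmetic of the constructed matrix\<close>

lemma dims:
  "dim_row F1 = n1" "dim_col F1 = m1" "dim_row F2 = n2" "dim_col F2 = m2"
  "dim_row D = K" "dim_col D = n2"
  using F1 F2 ND
  by (auto simp: design_def normalized_difference_matrix_def difference_matrix_def)

lemma n2_gt_1: "n2 > 1" and D_first: "k < K \<Longrightarrow> D $$ (k, 0) = \<one>"
  and D_closed: "k < K \<Longrightarrow> t < n2 \<Longrightarrow> D $$ (k, t) \<in> carrier \<A>1"
  using ND by (auto simp: normalized_difference_matrix_def difference_matrix_def)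

lemma F1_closed: "s < n1 \<Longrightarrow> j < m1 \<Longrightarrow> F1 $$ (s, j) \<in> carrier \<A>1"
  and F2_less: "t < n2 \<Longrightarrow> i < m2 \<Longrightarrow> F2 $$ (t, i) < q2"
  using design_less[OF F1, of j s] design_less[OF F2, of i t] by (simp_all add: carrier)

lemma dim_F: "dim_row F = n1 * n2" "dim_col F = m1 * K + m2"
  unfolding F_def append_columns_def kronecker_sum_def by (simp_all add: dims)

lemma length_qs: "length qs = m1 * K + m2"
  by (simp add: qs_def mult_ac)

lemma qs_left: "v < m1 * K \<Longrightarrow> qs ! v = q1"
  by (simp add: qs_def nth_append mult_ac)

lemma qs_right: "i < m2 \<Longrightarrow> qs ! (m1 * K + i) = q2"
  by (simp add: qs_def nth_append mult_ac)

lemma F_left: "u < n1 * n2 \<Longrightarrow> v < m1 * K \<Longrightarrow>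
    F $$ (u, v) = F1 $$ (u div n2, v div K) \<otimes> D $$ (v mod K, u mod n2)"
  using n2_gt_1 unfolding F_def append_columns_def kronecker_sum_def
  by (cases "K = 0") (simp_all add: dims)

text \<open>Summing with the zero column stacks copies of \<open>F2\<close>, so only the position
  inside the block matters.\<close>

lemma F_right: "u < n1 * n2 \<Longrightarrow> i < m2 \<Longrightarrow> F $$ (u, m1 * K + i) = F2 $$ (u mod n2, i)"
  using n2_gt_1 unfolding F_def append_columns_def kronecker_sum_def
  by (simp add: dims less_mult_imp_div_less)

lemma column_cases:
  assumes "v < length qs"
  obtains (left) "v < m1 * K" | (right) i where "i < m2" "v = m1 * K + i"
  using assms unfolding length_qs by (metis add_diff_inverse_nat nat_add_left_cancel_less)

lemma left_index:
  assumes "v < m1 * K"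
  shows "v div K < m1" "v mod K < K"
proof -
  have "K > 0" using assms by (cases "K = 0") simp_all
  then show "v mod K < K" by (rule mod_less_divisor)
qed (use assms in \<open>rule less_mult_imp_div_less\<close>)

lemma row_index: "u < n1 * n2 \<Longrightarrow> u div n2 < n1" "u < n1 * n2 \<Longrightarrow> u mod n2 < n2"
  using n2_gt_1 by (auto simp: less_mult_imp_div_less)

lemma block_index:
  assumes "s < n1" "t < n2"
  shows "s * n2 + t < n1 * n2" "(s * n2 + t) div n2 = s" "(s * n2 + t) mod n2 = t"
proof -
  have "s * n2 + t < Suc s * n2" using assms by simp
  also have "\<dots> \<le> n1 * n2" using assms by (intro mult_le_mono1) simp
  finally show "s * n2 + t < n1 * n2" .
qed (use assms in simp_all)

section \<open>Balance of the constructed design\<close>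

lemma F1_level_card: "j < m1 \<Longrightarrow> a < q1 \<Longrightarrow> q1 * card {s. s < n1 \<and> F1 $$ (s, j) = a} = n1"
  using design_level_card[OF F1, of j a] by simp

lemma F1_level_attained:
  assumes "n1 \<ge> 1" "j < m1" "a < q1"
  shows "\<exists>s<n1. F1 $$ (s, j) = a"
proof -
  have "card {s. s < n1 \<and> F1 $$ (s, j) = a} \<noteq> 0"
    using F1_level_card[OF assms(2,3)] assms(1) by (metis mult_0_right not_one_le_zero)
  then have "{s. s < n1 \<and> F1 $$ (s, j) = a} \<noteq> {}" by (metis card.empty)
  then show ?thesis by blast
qed

lemma eq_mult_iff:
  assumes "x \<in> carrier \<A>1" "y \<in> carrier \<A>1" "a \<in> carrier \<A>1"
  shows "x \<otimes> y = a \<longleftrightarrow> x = a \<otimes> inv y"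
  using assms inv_solve_right[of x a y] by auto

text \<open>In a left column, for fixed position \<open>t\<close> in the blocks, adding an entry of
  \<open>D\<close> permutes the levels of a balanced column of \<open>F1\<close>. A right column
  repeats a column of \<open>F2\<close> \<open>n1\<close> times.\<close>

lemma design_F: "design (n1 * n2) qs F"
  unfolding design_iff
proof (intro conjI allI impI)
  show "F \<in> carrier_mat (n1 * n2) (length qs)"
    using dim_F length_qs by auto
next
  fix v u assume v: "v < length qs" and u: "u < n1 * n2"
  from v show "F $$ (u, v) < qs ! v"
  proof (cases rule: column_cases)
    case left
    have "F $$ (u, v) \<in> carrier \<A>1"
      using F1_closed D_closed left_index[OF left] row_index[OF u] by (simp add: F_left[OF u left])
    then show ?thesis by (simp add: carrier qs_left[OF left])
  next
    case (right i)
    then show ?thesis using F_right[OF u] qs_right F2_less row_index[OF u] by simp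
  qed
next
  fix v a b assume v: "v < length qs" and a: "a < qs ! v" and b: "b < qs ! v"
  \<comment> \<open>Equality of all level counts is obtained by showing that each equals one value
    independent of the level.\<close>
  have "\<exists>c::real. \<forall>a<qs ! v. (\<Sum>u<n1 * n2. of_bool (F $$ (u, v) = a)) = c"
    using v
  proof (cases rule: column_cases)
    case left
    let ?j = "v div K" and ?k = "v mod K"
    note jk = left_index[OF left]
    have "(\<Sum>u<n1 * n2. of_bool (F $$ (u, v) = a)) =
        (\<Sum>t<n2. real (card {s. s < n1 \<and> F1 $$ (s, ?j) = 0}))" if a: "a < qs ! v" for a
    proof -
      have a': "a \<in> carrier \<A>1" using a by (simp add: qs_left[OF left] carrier)
      have "(\<Sum>u<n1 * n2. of_bool (F $$ (u, v) = a)) =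
          (\<Sum>u<n1 * n2. of_bool (F1 $$ (u div n2, ?j) \<otimes> D $$ (?k, u mod n2) = a) :: real)"
        by (intro sum.cong refl) (simp add: F_left left)
      also have "\<dots> = (\<Sum>s<n1. \<Sum>t<n2. of_bool (F1 $$ (s, ?j) \<otimes> D $$ (?k, t) = a))"
        by (rule sum_divmod)
      also have "\<dots> = (\<Sum>t<n2. \<Sum>s<n1. of_bool (F1 $$ (s, ?j) = a \<otimes> inv D $$ (?k, t)))"
        by (subst sum.swap, intro sum.cong refl) (simp add: eq_mult_iff F1_closed D_closed jk a')
      also have "\<dots> = (\<Sum>t<n2. real (card {s. s < n1 \<and> F1 $$ (s, ?j) = a \<otimes> inv D $$ (?k, t)}))"
        by (simp add: card_eq_sum_of_bool)
      \<comment> \<open>The shifted level depends on \<open>t\<close>; balance of \<open>F1\<close>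
        replaces it by the reference level \<open>0\<close>.\<close>
      also have "\<dots> = (\<Sum>t<n2. real (card {s. s < n1 \<and> F1 $$ (s, ?j) = 0}))"
      proof (intro sum.cong refl arg_cong[where f = real] design_level_card_unique[OF F1])
        fix t assume "t \<in> {..<n2}"
        then have "a \<otimes> inv D $$ (?k, t) \<in> carrier \<A>1" using a' D_closed jk by simp
        then show "a \<otimes> inv D $$ (?k, t) < replicate m1 q1 ! ?j" using jk by (simp add: carrier)
      qed (use q1 jk in simp_all)
      finally show ?thesis .
    qed
    then show ?thesis by blast
  next
    case (right i)
    have "(\<Sum>u<n1 * n2. of_bool (F $$ (u, v) = a)) =
        real n1 * real (card {t. t < n2 \<and> F2 $$ (t, i) = 0})" if a: "a < qs ! v" for a
    proof -
      have "(\<Sum>u<n1 * n2. of_bool (F $$ (u, v) = a)) =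
          (\<Sum>u<n1 * n2. of_bool (F2 $$ (u mod n2, i) = a) :: real)"
        by (intro sum.cong refl) (simp add: F_right right)
      also have "\<dots> = (\<Sum>s<n1. \<Sum>t<n2. of_bool (F2 $$ (t, i) = a))"
        by (rule sum_divmod)
      also have "\<dots> = real n1 * real (card {t. t < n2 \<and> F2 $$ (t, i) = a})"
        by (simp add: card_eq_sum_of_bool)
      also have "card {t. t < n2 \<and> F2 $$ (t, i) = a} = card {t. t < n2 \<and> F2 $$ (t, i) = 0}"
      proof -
        have "a < q2" "0 < q2" using right a q2 qs_right[OF right(1)] by simp_all
        then show ?thesis
          using design_level_card_unique[OF F2, of i a 0] right(1) by simp
      qed
      finally show ?thesis .
    qed
    then show ?thesis by blast
  qed
  then obtain c :: real
    where c: "\<And>a. a < qs ! v \<Longrightarrow> (\<Sum>u<n1 * n2. of_bool (F $$ (u, v) = a)) = c"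
    by blast
  have "real (card {u. u < n1 * n2 \<and> F $$ (u, v) = a}) =
      real (card {u. u < n1 * n2 \<and> F $$ (u, v) = b})"
    unfolding card_eq_sum_of_bool c[OF a] c[OF b] ..
  then show "card {u. u < n1 * n2 \<and> F $$ (u, v) = a} = card {u. u < n1 * n2 \<and> F $$ (u, v) = b}"
    by simp
qed

section \<open>Absence of fully aliased columns\<close>

text \<open>On the first rows of the blocks the right column is constant, while the left one is a
  column of \<open>F1\<close> and takes the values 0 and 1. An arbitrary injection \<open>g\<close>
  covers a permutation and its inverse, hence both directions of aliasing.\<close>

lemma left_right_not_permuted:
  assumes n1: "n1 \<ge> 1" and v: "v < m1 * K" and i: "i < m2" and g: "inj g"
  shows "\<exists>u<n1 * n2. g (F $$ (u, v)) \<noteq> F $$ (u, m1 * K + i)"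
proof (rule ccontr)
  assume "\<not> (\<exists>u<n1 * n2. g (F $$ (u, v)) \<noteq> F $$ (u, m1 * K + i))"
  then have eq: "g (F $$ (u, v)) = F $$ (u, m1 * K + i)" if "u < n1 * n2" for u
    using that by blast
  note jk = left_index[OF v]
  have *: "g (F1 $$ (x, v div K)) = F2 $$ (0, i)" if x: "x < n1" for x
  proof -
    \<comment> \<open>Row \<open>x * n2\<close> is the first row of block \<open>x\<close>, where
      \<open>D\<close> contributes the identity.\<close>
    have u: "x * n2 < n1 * n2" using x n2_gt_1 by simp
    have "F $$ (x * n2, v) = F1 $$ (x, v div K)"
      using F_left[OF u v] n2_gt_1 D_first[OF jk(2)] F1_closed[OF x jk(1)] by simp
    then show ?thesis using eq[OF u] F_right[OF u i] by simp
  qed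
  obtain s s' where "s < n1" "F1 $$ (s, v div K) = 0" "s' < n1" "F1 $$ (s', v div K) = 1"
    using F1_level_attained[OF n1 jk(1), of 0] F1_level_attained[OF n1 jk(1), of 1] q1 by auto
  then have "g 0 = g 1" using *[of s] *[of s'] by simp
  then show False using g by (auto dest: injD)
qed

text \<open>
  Normalization makes the rows \<open>t = 0\<close> of the left part a copy of the columns of \<open>F1\<close>, so an
  aliasing of left columns is one of \<open>F1\<close>, or is the identity and exhibits two equal rows of \<open>D\<close>.
\<close>

lemma no_fully_aliased_columns_F:
  assumes n1: "n1 \<ge> 1"
    and NA1: "no_fully_aliased_columns (replicate m1 q1) F1"
    and NA2: "no_fully_aliased_columns (replicate m2 q2) F2"
    and D: "identical_rows_free D"
  shows "no_fully_aliased_columns qs F"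
  unfolding no_fully_aliased_columns_def
proof (intro allI impI notI)
  fix v w assume v: "v < length qs" and w: "w < length qs" and vw: "v \<noteq> w"
    and "fully_aliased qs F v w"
  then obtain \<pi> where q: "qs ! v = qs ! w" and \<pi>: "\<pi> permutes {..<qs ! v}"
    and eq: "\<And>u. u < n1 * n2 \<Longrightarrow> F $$ (u, w) = \<pi> (F $$ (u, v))"
    by (auto simp: fully_aliased_def dim_F)
  from v show False
  proof (cases rule: column_cases)
    case v: left
    from w show False
    proof (cases rule: column_cases)
      case w: left
      note jk = left_index[OF v] and jk' = left_index[OF w]
      have eq_blocks: "F1 $$ (s, w div K) \<otimes> D $$ (w mod K, t) = \<pi> (F1 $$ (s, v div K) \<otimes> D $$ (v mod K, t))"
        if "s < n1" "t < n2" for s t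
        using eq[OF block_index(1)[OF that]] block_index[OF that] by (simp add: F_left v w)
      have eq0: "F1 $$ (s, w div K) = \<pi> (F1 $$ (s, v div K))" if "s < n1" for s
        using eq_blocks[OF that, of 0] n2_gt_1 F1_closed[OF that] jk jk' by (simp add: D_first)
      show False
      proof (cases "v div K = w div K")
        case False
        have "fully_aliased (replicate m1 q1) F1 (v div K) (w div K)"
          unfolding fully_aliased_def
        proof (intro conjI exI[of _ \<pi>] allI impI)
          show "\<pi> permutes {..<replicate m1 q1 ! (v div K)}"
            using \<pi> jk qs_left[OF v] by simp
        qed (use eq0 jk jk' in \<open>simp_all add: dims\<close>)
        then show False
          using NA1 jk jk' False by (simp add: no_fully_aliased_columns_def)
      next
        case True
        \<comment> \<open>Both columns stem from the same column of \<open>F1\<close>, so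
          \<open>\<pi>\<close> fixes each of its entries, and by balance every level occurs among
          them.\<close>
        have \<pi>_id: "\<pi> a = a" if "a < q1" for a
        proof -
          obtain s where "s < n1" "F1 $$ (s, v div K) = a"
            using F1_level_attained[OF n1 jk(1) \<open>a < q1\<close>] by blast
          then show ?thesis using eq0[of s] unfolding True by simp
        qed
        obtain s where s: "s < n1" "F1 $$ (s, v div K) = 0"
          using F1_level_attained[OF n1 jk(1), of 0] q1 by auto
        have "D $$ (v mod K, t) = D $$ (w mod K, t)" if t: "t < n2" for t
        proof -
          have c: "F1 $$ (s, v div K) \<in> carrier \<A>1" "D $$ (v mod K, t) \<in> carrier \<A>1"
            "D $$ (w mod K, t) \<in> carrier \<A>1"
            using F1_closed[OF s(1) jk(1)] D_closed[OF jk(2) t] D_closed[OF jk'(2) t] by simp_all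
          then have "F1 $$ (s, v div K) \<otimes> D $$ (v mod K, t) \<in> carrier \<A>1" by simp
          then have "F1 $$ (s, v div K) \<otimes> D $$ (v mod K, t) < q1" by (simp add: carrier)
          then have "F1 $$ (s, v div K) \<otimes> D $$ (w mod K, t) = F1 $$ (s, v div K) \<otimes> D $$ (v mod K, t)"
            using eq_blocks[OF s(1) t] \<pi>_id True by simp
          then show ?thesis using c by simp
        qed
        then have "row D (v mod K) = row D (w mod K)"
          using jk jk' by (intro eq_vecI) (simp_all add: dims)
        moreover have "v mod K \<noteq> w mod K"
          using True vw by (metis div_mult_mod_eq)
        ultimately show False
          using D jk jk' by (simp add: identical_rows_free_def dims)
      qed
    next
      case (right i)
      then show False
        using left_right_not_permuted[OF n1 v right(1) permutes_inj[OF \<pi>]] eq by metis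
    qed
  next
    case v: (right i)
    from w show False
    proof (cases rule: column_cases)
      case w: left
      \<comment> \<open>Here the left column is the image, so the relation is inverted before the
        previous lemma applies.\<close>
      have "inv_into UNIV \<pi> (F $$ (u, w)) = F $$ (u, m1 * K + i)" if "u < n1 * n2" for u
        using eq[OF that] v permutes_inj[OF \<pi>] by simp
      moreover have "inj (inv_into UNIV \<pi>)"
        using permutes_surj[OF \<pi>] by (rule surj_imp_inj_inv)
      ultimately show False
        using left_right_not_permuted[OF n1 w v(1)] by blast
    next
      case w: (right i')
      have eq2: "F2 $$ (t, i') = \<pi> (F2 $$ (t, i))" if "t < n2" for t
      proof -
        \<comment> \<open>The first block of rows already contains a full copy of
          \<open>F2\<close>.\<close>
        have "t < n1 * n2" using block_index(1)[of 0 t] n1 that by simp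
        then show ?thesis using eq[of t] F_right[of t] v w that by simp
      qed
      have "fully_aliased (replicate m2 q2) F2 i i'"
        unfolding fully_aliased_def
      proof (intro conjI exI[of _ \<pi>] allI impI)
        show "\<pi> permutes {..<replicate m2 q2 ! i}"
          using \<pi> v qs_right[of i] by simp
      qed (use eq2 v w in \<open>simp_all add: dims\<close>)
      then show False
        using NA2 v w vw by (simp add: no_fully_aliased_columns_def)
    qed
  qed
qed

section \<open>Coincidence numbers of the constructed design\<close>

text \<open>The \<open>r * q1\<close> differences are spread evenly over the \<open>q1\<close> group
  elements.\<close>

lemma difference_count:
  assumes "t < n2" "t' < n2" "t \<noteq> t'" "x \<in> carrier \<A>1"
  shows "card {k. k < K \<and> D $$ (k, t) \<otimes> inv D $$ (k, t') = x} = r"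
proof -
  have "card (carrier \<A>1) * card {k. k < K \<and> D $$ (k, t) \<otimes> inv D $$ (k, t') = x} = K"
  proof (rule equal_counts_lessThan)
    fix x y assume "x \<in> carrier \<A>1" "y \<in> carrier \<A>1"
    then show "card {k. k < K \<and> D $$ (k, t) \<otimes> inv D $$ (k, t') = x} =
        card {k. k < K \<and> D $$ (k, t) \<otimes> inv D $$ (k, t') = y}"
      using ND assms(1-3) unfolding normalized_difference_matrix_def difference_matrix_def by blast
  next
    fix k assume "k < K"
    then show "D $$ (k, t) \<otimes> inv D $$ (k, t') \<in> carrier \<A>1" using D_closed assms by simp
  qed (use assms carrier in simp_all)
  then show ?thesis using q1 by (simp add: carrier)
qed

text \<open>For each \<open>j\<close>, agreement means that the difference of two entries in row
  \<open>k\<close> of \<open>D\<close> equals a group element fixed by \<open>s\<close>,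
  \<open>s'\<close> and \<open>j\<close>. This happens for \<open>r\<close> values of
  \<open>k\<close>, also when \<open>s = s'\<close>.\<close>

lemma left_coincidence_diff:
  assumes s: "s < n1" "s' < n1" and t: "t < n2" "t' < n2" "t \<noteq> t'"
  shows "(\<Sum>j<m1. \<Sum>k<K. of_bool (F1 $$ (s, j) \<otimes> D $$ (k, t) = F1 $$ (s', j) \<otimes> D $$ (k, t'))) =
    real (r * m1)"
proof -
  have "(\<Sum>k<K. of_bool (F1 $$ (s, j) \<otimes> D $$ (k, t) = F1 $$ (s', j) \<otimes> D $$ (k, t'))) = real r"
    if j: "j < m1" for j
  proof -
    have "F1 $$ (s, j) \<otimes> D $$ (k, t) = F1 $$ (s', j) \<otimes> D $$ (k, t') \<longleftrightarrow>
        D $$ (k, t) \<otimes> inv D $$ (k, t') = inv F1 $$ (s, j) \<otimes> F1 $$ (s', j)" if k: "k < K" for k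
    proof -
      note c [simp] = F1_closed[OF s(1) j] F1_closed[OF s(2) j] D_closed[OF k t(1)] D_closed[OF k t(2)]
      have "F1 $$ (s, j) \<otimes> D $$ (k, t) = F1 $$ (s', j) \<otimes> D $$ (k, t') \<longleftrightarrow>
          D $$ (k, t) = inv F1 $$ (s, j) \<otimes> (F1 $$ (s', j) \<otimes> D $$ (k, t'))"
        using inv_solve_left[of "D $$ (k, t)" "F1 $$ (s, j)" "F1 $$ (s', j) \<otimes> D $$ (k, t')"] by auto
      also have "\<dots> \<longleftrightarrow> D $$ (k, t) = (inv F1 $$ (s, j) \<otimes> F1 $$ (s', j)) \<otimes> D $$ (k, t')"
        by (simp add: m_assoc)
      also have "\<dots> \<longleftrightarrow> D $$ (k, t) \<otimes> inv D $$ (k, t') = inv F1 $$ (s, j) \<otimes> F1 $$ (s', j)"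
        using inv_solve_right'[of "inv F1 $$ (s, j) \<otimes> F1 $$ (s', j)" "D $$ (k, t)" "D $$ (k, t')"]
        by auto
      finally show ?thesis .
    qed
    then have "(\<Sum>k<K. of_bool (F1 $$ (s, j) \<otimes> D $$ (k, t) = F1 $$ (s', j) \<otimes> D $$ (k, t'))) =
        (\<Sum>k<K. of_bool (D $$ (k, t) \<otimes> inv D $$ (k, t') = inv F1 $$ (s, j) \<otimes> F1 $$ (s', j)) :: real)"
      by (intro sum.cong refl) simp
    also have "\<dots> = real r"
      using difference_count[OF t, of "inv F1 $$ (s, j) \<otimes> F1 $$ (s', j)"] F1_closed s j
      by (simp flip: card_eq_sum_of_bool)
    finally show ?thesis .
  qed
  then show ?thesis by (simp add: mult.commute)
qed

text \<open>The common entry of \<open>D\<close> cancels, so each coincidence in \<open>F1\<close>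
  is repeated for all \<open>K\<close> values of \<open>k\<close>.\<close>

lemma left_coincidence_same:
  assumes s: "s < n1" "s' < n1" and t: "t < n2"
  shows "(\<Sum>j<m1. \<Sum>k<K. of_bool (F1 $$ (s, j) \<otimes> D $$ (k, t) = F1 $$ (s', j) \<otimes> D $$ (k, t))) =
    real (K * coincidence_number F1 s s')"
proof -
  have "(\<Sum>j<m1. \<Sum>k<K. of_bool (F1 $$ (s, j) \<otimes> D $$ (k, t) = F1 $$ (s', j) \<otimes> D $$ (k, t))) =
      (\<Sum>j<m1. \<Sum>k<K. agree F1 j s s')"
    unfolding agree_def using s t F1_closed D_closed by (intro sum.cong refl) simp
  also have "\<dots> = real (K * coincidence_number F1 s s')"
    by (simp add: coincidence_number_eq_sum dims sum_distrib_left)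
  finally show ?thesis .
qed

text \<open>The weight is constant on each of the two groups of columns, so it can be taken out of
  both partial sums.\<close>

lemma weighted_coincidence_F:
  assumes u: "u < n1 * n2" "u' < n1 * n2"
    and w_left: "\<And>v. v < m1 * K \<Longrightarrow> w v = x" and w_right: "\<And>i. i < m2 \<Longrightarrow> w (m1 * K + i) = y"
  shows "weighted_coincidence w F u u' =
    x * (\<Sum>j<m1. \<Sum>k<K. of_bool (F1 $$ (u div n2, j) \<otimes> D $$ (k, u mod n2) =
                                 F1 $$ (u' div n2, j) \<otimes> D $$ (k, u' mod n2))) +
    y * real (coincidence_number F2 (u mod n2) (u' mod n2))"
proof -
  have "(\<Sum>v<m1 * K. w v * agree F v u u') =
      (\<Sum>v<m1 * K. x * of_bool (F1 $$ (u div n2, v div K) \<otimes> D $$ (v mod K, u mod n2) =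
                                 F1 $$ (u' div n2, v div K) \<otimes> D $$ (v mod K, u' mod n2)))"
    by (intro sum.cong refl) (simp add: agree_def F_left u w_left)
  also have "\<dots> = (\<Sum>j<m1. \<Sum>k<K. x * of_bool (F1 $$ (u div n2, j) \<otimes> D $$ (k, u mod n2) =
                                 F1 $$ (u' div n2, j) \<otimes> D $$ (k, u' mod n2)))"
    by (rule sum_divmod)
  finally have left: "(\<Sum>v<m1 * K. w v * agree F v u u') =
      x * (\<Sum>j<m1. \<Sum>k<K. of_bool (F1 $$ (u div n2, j) \<otimes> D $$ (k, u mod n2) =
                                 F1 $$ (u' div n2, j) \<otimes> D $$ (k, u' mod n2)))"
    by (simp only: sum_distrib_left)
  have "(\<Sum>i<m2. w (m1 * K + i) * agree F (m1 * K + i) u u') =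
      (\<Sum>i<m2. y * agree F2 i (u mod n2) (u' mod n2))"
    by (intro sum.cong refl) (simp add: agree_def F_right u w_right)
  also have "\<dots> = y * real (coincidence_number F2 (u mod n2) (u' mod n2))"
    by (simp add: coincidence_number_eq_sum dims sum_distrib_left)
  finally show ?thesis
    unfolding weighted_coincidence_def dim_F sum_lessThan_add left by simp
qed

lemma weighted_coincidence_F_cases:
  assumes "constant_coincidence F1 l1" "constant_coincidence F2 l2"
    and u: "u < n1 * n2" "u' < n1 * n2" "u \<noteq> u'"
    and w: "\<And>v. v < m1 * K \<Longrightarrow> w v = x" "\<And>i. i < m2 \<Longrightarrow> w (m1 * K + i) = y"
  shows "weighted_coincidence w F u u' = x * real (r * m1) + y * real l2 \<or>
    weighted_coincidence w F u u' = x * real (K * l1) + y * real m2"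
proof (cases "u mod n2 = u' mod n2")
  case False
  have "coincidence_number F2 (u mod n2) (u' mod n2) = l2"
    using assms(2) row_index u False by (simp add: constant_coincidence_def dims)
  then show ?thesis
    using left_coincidence_diff[OF _ _ _ _ False, of "u div n2" "u' div n2"] row_index u
    by (simp add: weighted_coincidence_F[where x = x and y = y, OF u(1,2)] w)
next
  case True
  \<comment> \<open>Distinct rows at the same position must lie in different blocks, so the constant
    coincidence of \<open>F1\<close> applies.\<close>
  then have "u div n2 \<noteq> u' div n2" using u(3) by (metis div_mult_mod_eq)
  then have "coincidence_number F1 (u div n2) (u' div n2) = l1"
    using assms(1) row_index u by (simp add: constant_coincidence_def dims)
  moreover have "coincidence_number F2 (u' mod n2) (u' mod n2) = m2"
    by (simp add: coincidence_number_def dims)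
  ultimately show ?thesis
    using left_coincidence_same[of "u div n2" "u' div n2" "u' mod n2"] row_index u True
    by (simp add: weighted_coincidence_F[where x = x and y = y, OF u(1,2)] w)
qed

section \<open>Optimality of the constructed design\<close>

lemma qs_pos: "j < length qs \<Longrightarrow> qs ! j > 0"
  using q1 q2 qs_left qs_right by (auto elim!: column_cases)

lemma E_f_NOD_optimal_F:
  assumes "constant_coincidence F1 l1" "constant_coincidence F2 l2"
    and "\<bar>(int l2 + int r * int m1) - (int m2 + int l1 * int r * int q1)\<bar> \<le> 1"
  shows "E_f_NOD_optimal (n1 * n2) qs F"
proof (rule E_f_NOD_optimalI[OF design_F qs_pos])
  show "\<bar>int (l2 + r * m1) - int (m2 + l1 * r * q1)\<bar> \<le> 1" using assms(3) by simp
  fix u v assume "u < n1 * n2" "v < n1 * n2" "u \<noteq> v"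
  from weighted_coincidence_F_cases[OF assms(1,2) this, of "\<lambda>_. 1" 1 1]
  have "real (coincidence_number F u v) = real (l2 + r * m1) \<or>
      real (coincidence_number F u v) = real (m2 + l1 * r * q1)"
    by (simp add: weighted_coincidence_def coincidence_number_eq_sum algebra_simps)
  then show "coincidence_number F u v = l2 + r * m1 \<or> coincidence_number F u v = m2 + l1 * r * q1"
    by (simp only: of_nat_eq_iff)
qed

text \<open>With weights \<open>q1\<close> and \<open>q2\<close> the two possible coincidence values
  are the two sides of \<open>eq\<close>, so only one value remains.\<close>

lemma chi2_optimal_F:
  assumes "constant_coincidence F1 l1" "constant_coincidence F2 l2"
    and eq: "q2 * l2 + q1 * r * m1 = q2 * m2 + l1 * r * q1\<^sup>2"
  shows "chi2_optimal (n1 * n2) qs F"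
proof (rule chi2_optimalI[OF design_F qs_pos])
  fix u v assume "u < n1 * n2" "v < n1 * n2" "u \<noteq> v"
  then have "weighted_coincidence (\<lambda>j. real (qs ! j)) F u v = real q1 * real (r * m1) + real q2 * real l2 \<or>
      weighted_coincidence (\<lambda>j. real (qs ! j)) F u v = real q1 * real (K * l1) + real q2 * real m2"
    by (intro weighted_coincidence_F_cases[OF assms(1,2)]) (simp_all add: qs_left qs_right)
  then have "weighted_coincidence (\<lambda>j. real (qs ! j)) F u v = real (q2 * l2 + q1 * r * m1) \<or>
      weighted_coincidence (\<lambda>j. real (qs ! j)) F u v = real (q2 * m2 + l1 * r * q1\<^sup>2)"
    by (simp add: algebra_simps power2_eq_square)
  then show "weighted_coincidence (\<lambda>j. real (qs ! j)) F u v = real (q2 * l2 + q1 * r * m1)"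
    unfolding eq by simp
qed

end

theorem theorem3:
  fixes n1 n2 q1 q2 m1 m2 r l1 l2 :: nat
    and \<A>1 :: "nat monoid"
    and F1 F2 D F :: "nat mat"
    and qs :: "nat list"
  assumes "n1 \<ge> 1" and "n2 \<ge> 1" and "q1 \<ge> 2" and "q2 \<ge> 2"
    and "design n1 (replicate m1 q1) F1"
    and "constant_coincidence F1 l1"
    and "no_fully_aliased_columns (replicate m1 q1) F1"
    and "design n2 (replicate m2 q2) F2"
    and "constant_coincidence F2 l2"
    and "no_fully_aliased_columns (replicate m2 q2) F2"
    and "carrier \<A>1 = {0..<q1}"
    and "normalized_difference_matrix \<A>1 r n2 q1 D"
    and "identical_rows_free D"
    and F_def: "F = append_columns (kronecker_sum (mult \<A>1) F1 (transpose_mat D))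
                                   (kronecker_sum (+) (0\<^sub>m n1 1) F2)"
    and qs_def: "qs = replicate (r * m1 * q1) q1 @ replicate m2 q2"
  shows "design (n1 * n2) qs F \<and> no_fully_aliased_columns qs F \<and>
    (\<bar>(int l2 + int r * int m1) - (int m2 + int l1 * int r * int q1)\<bar> \<le> 1 \<longrightarrow>
       E_f_NOD_optimal (n1 * n2) qs F) \<and>
    (q2 * l2 + q1 * r * m1 = q2 * m2 + l1 * r * q1\<^sup>2 \<longrightarrow> chi2_optimal (n1 * n2) qs F)"
proof -
  interpret kronecker_design n1 n2 q1 q2 m1 m2 r \<A>1 F1 F2 D F qs
    using assms by unfold_locales
  show ?thesis
    using assms design_F no_fully_aliased_columns_F E_f_NOD_optimal_F chi2_optimal_F by blast
qed

end
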